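(* Let $G$ be a finite simple graph and $k$ a positive integer. If $G$ has a redundant identifying code of cardinality at most $k$ (i.e. $\mathrm{RED{:}IC}(G) \le k$), then $|V(G)| \le 2^{k-1} - 1$.
   Context: $N[v]$ denotes the closed neighborhood of $v$ and $\Delta$ symmetric difference. A set $S \subseteq V(G)$ is a redundant identifying code if every vertex $v$ satisfies $|N[v] \cap S| \ge 2$ and every pair of distinct vertices $u,v$ satisfies $|(N[u]\cap S)\,\Delta\,(N[v]\cap S)| \ge 2$. $\mathrm{RED{:}IC}(G)$ is the minimum cardinality of such a set. *)

theory Defs
  imports "Graph_Theory.Digraph" "HOL-Library.Extended_Nat"
begin

(* The locale predicate graph describes finite symmetric digraphs without loops and without
   parallel arcs, i.e. finite simple graphs; each edge {u, v} is a pair of opposite arcs. *)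

definition closed_nbhd :: "('a, 'b) pre_digraph \<Rightarrow> 'a \<Rightarrow> 'a set" where
  "closed_nbhd G v = insert v {u. v \<rightarrow>\<^bsub>G\<^esub> u}"

definition redundant_identifying_code :: "('a, 'b) pre_digraph \<Rightarrow> 'a set \<Rightarrow> bool" where
  "redundant_identifying_code G S \<longleftrightarrow>
     S \<subseteq> verts G \<and>
     (\<forall>v \<in> verts G. card (closed_nbhd G v \<inter> S) \<ge> 2) \<and>
     (\<forall>u \<in> verts G. \<forall>v \<in> verts G. u \<noteq> v \<longrightarrow>
        card (sym_diff (closed_nbhd G u \<inter> S) (closed_nbhd G v \<inter> S)) \<ge> 2)"

(* The minimum cardinality of a redundant identifying code; it is infinite if G has none. *)
definition RED_IC :: "('a, 'b) pre_digraph \<Rightarrow> enat" where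
  "RED_IC G = (INF S \<in> {S. redundant_identifying_code G S}. enat (card S))"

lemma RED_IC_le_iff:
  "RED_IC G \<le> enat k \<longleftrightarrow> (\<exists>S. redundant_identifying_code G S \<and> card S \<le> k)"
proof
  assume le: "RED_IC G \<le> enat k"
  let ?A = "(\<lambda>S. enat (card S)) ` {S. redundant_identifying_code G S}"
  have "?A \<noteq> {}"
  proof
    assume "?A = {}"
    then have "RED_IC G = \<infinity>"
      unfolding RED_IC_def by (simp only: Inf_enat_def simp_thms if_True)
    with le show False by simp
  qed
  then have "Inf ?A \<in> ?A"
    by (metis (no_types, lifting) wellorder_InfI ex_in_conv)
  with le show "\<exists>S. redundant_identifying_code G S \<and> card S \<le> k"
    unfolding RED_IC_def by auto
next
  assume "\<exists>S. redundant_identifying_code G S \<and> card S \<le> k"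
  then obtain S where S: "redundant_identifying_code G S" "card S \<le> k" by blast
  have "RED_IC G \<le> enat (card S)"
    unfolding RED_IC_def by (rule INF_lower) (simp add: S)
  also have "\<dots> \<le> enat k" using S by simp
  finally show "RED_IC G \<le> enat k" .
qed

end

theory Submission
  imports Defs
begin

text \<open>The traces \<open>N[v] \<inter> S\<close> together with \<open>{}\<close> form a code of minimum distance 2 in the cube on \<open>S\<close>, so
  they stay distinct when one coordinate is deleted.\<close>

lemma redundant_identifying_code_card_verts:
  assumes code: "redundant_identifying_code G S" and fin: "finite S"
  shows "card (verts G) \<le> 2 ^ (card S - 1) - 1"
proof (cases "verts G = {}")
  case False
  let ?I = "\<lambda>v. closed_nbhd G v \<inter> S"
  have dom: "card (?I v) \<ge> 2" if "v \<in> verts G" for v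
    using code that by (simp add: redundant_identifying_code_def)
  have sep: "card (sym_diff (?I u) (?I v)) \<ge> 2"
    if "u \<in> verts G" "v \<in> verts G" "u \<noteq> v" for u v
    using code that by (simp add: redundant_identifying_code_def)
  \<comment> \<open>Some vertex exists and its trace has at least two elements, so there is a
    coordinate \<open>s\<close> to delete.\<close>
  have "S \<noteq> {}"
    using False dom by fastforce
  then obtain s where s: "s \<in> S"
    by blast
  let ?f = "\<lambda>v. ?I v - {s}"
  have small: "\<not> 2 \<le> card A" if "A \<subseteq> {s}" for A
    using card_mono[OF _ that] by simp
  have "inj_on ?f (verts G)"
  proof (rule inj_onI)
    fix u v
    assume uv: "u \<in> verts G" "v \<in> verts G" and eq: "?f u = ?f v"
    \<comment> \<open>Traces that agree off \<open>s\<close> can differ only at \<open>s\<close>,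
      too little for two distinct vertices.\<close>
    have "sym_diff (?I u) (?I v) \<subseteq> {s}"
      using eq by blast
    then show "u = v"
      using sep uv small by blast
  qed
  \<comment> \<open>A trace of size at least 2 keeps an element other than \<open>s\<close>; the
    missing empty set gives the final \<open>- 1\<close> of the bound.\<close>
  moreover have "?f ` verts G \<subseteq> Pow (S - {s}) - {{}}"
    using dom small by blast
  ultimately have "card (verts G) \<le> card (Pow (S - {s}) - {{}})"
    using fin by (intro card_inj_on_le) auto
  also have "\<dots> = 2 ^ (card S - 1) - 1"
    using fin s by (simp add: card_Diff_singleton card_Pow)
  finally show ?thesis .
qed simp

theorem theorem5:
  fixes G :: "('a, 'b) pre_digraph" and k :: nat
  assumes "graph G"
    and "k \<ge> 1"
    and "\<exists>S. redundant_identifying_code G S \<and> card S \<le> k"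
  shows "card (verts G) \<le> 2 ^ (k - 1) - 1"
proof -
  interpret graph G by fact
  obtain S where S: "redundant_identifying_code G S" "card S \<le> k"
    using assms(3) by blast
  \<comment> \<open>Finiteness comes from \<open>S \<subseteq> verts G\<close>;
    \<open>card S \<le> k\<close> alone would not give it, since infinite sets have
    \<open>card\<close> 0.\<close>
  then have "finite S"
    using finite_subset[OF _ finite_verts] by (simp add: redundant_identifying_code_def)
  with S have "card (verts G) \<le> 2 ^ (card S - 1) - 1"
    by (intro redundant_identifying_code_card_verts)
  also have "\<dots> \<le> 2 ^ (k - 1) - 1"
    using S(2) by (intro diff_le_mono power_increasing) auto
  finally show ?thesis .
qed

end
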